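(* Let $k,c,\rho,A,C,P_r>0$ and $0<V_{ci}<V_r<V_{co}$ be real numbers and put $a=\frac12\rho A C$. Let $V$ be a Weibull random variable with density $f_V(v)=\frac{k}{c}\left(\frac{v}{c}\right)^{k-1}e^{-(v/c)^k}$, $v>0$, and cumulative distribution function $F(v)=1-e^{-(v/c)^k}$. Let $P_w$ be the harvested wind power determined by $V$, i.e. $P_w=aV^3$ if $V_{ci}<V\le V_r$, $P_w=P_r$ if $V_r<V\le V_{co}$, and $P_w=0$ otherwise. Then the distribution of $P_w$ has the generalized density $$f_{P_w}(p)=\frac{k\,p^{\frac k3-1}\exp\left(-\frac{p^{k/3}}{a^{k/3}c^k}\right)}{3c^k a^{k/3}}\,\mathbf 1\{aV_{ci}^3<p<aV_r^3\}+\delta(p-P_r)\bigl(F(V_{co})-F(V_r)\bigr)+\delta(p)\bigl(F(V_{ci})+1-F(V_{co})\bigr),$$ i.e. the law of $P_w$ is the sum of the measure with the stated Lebesgue density on $(aV_{ci}^3,aV_r^3)$, a point mass $F(V_{co})-F(V_r)$ at $P_r$, and a point mass $F(V_{ci})+1-F(V_{co})$ at $0$.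
   Context: $V$ is the wind velocity; $V_{ci}$, $V_r$, $V_{co}$ are the cut-in, rated and cut-off velocities of a wind turbine, $P_r$ is its rated power, $\rho$ the air density, $A$ the rotor area, $C$ the power coefficient. $\delta$ is the Dirac delta and $\mathbf 1\{\cdot\}$ the indicator function. *)

theory Defs
  imports "HOL-Probability.Probability"
begin

definition weibull_density :: "real \<Rightarrow> real \<Rightarrow> real \<Rightarrow> real" where
  "weibull_density k c v =
     (if 0 < v then k / c * (v / c) powr (k - 1) * exp (- ((v / c) powr k)) else 0)"

definition weibull_cdf :: "real \<Rightarrow> real \<Rightarrow> real \<Rightarrow> real" where
  "weibull_cdf k c v = (if 0 < v then 1 - exp (- ((v / c) powr k)) else 0)"

definition harvested_power :: "real \<Rightarrow> real \<Rightarrow> real \<Rightarrow> real \<Rightarrow> real \<Rightarrow> real \<Rightarrow> real" where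
  "harvested_power a Vci Vr Vco Pr v =
     (if Vci < v \<and> v \<le> Vr then a * v ^ 3
      else if Vr < v \<and> v \<le> Vco then Pr
      else 0)"

lemma borel_measurable_harvested_power [measurable]:
  "harvested_power a Vci Vr Vco Pr \<in> borel_measurable borel"
  unfolding harvested_power_def by measurable

(* Setwise sum; meaningful only for measures with the same space and measurable sets. *)
definition add_measure :: "'a measure \<Rightarrow> 'a measure \<Rightarrow> 'a measure" where
  "add_measure M N = measure_of (space M) (sets M) (\<lambda>A. emeasure M A + emeasure N A)"

lemma space_add_measure [simp]: "space (add_measure M N) = space M"
  by (simp add: add_measure_def)

lemma sets_add_measure [simp, measurable_cong]: "sets (add_measure M N) = sets M"
  by (simp add: add_measure_def)

lemma emeasure_add_measure:
  assumes sets: "sets N = sets M" and A: "A \<in> sets M"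
  shows "emeasure (add_measure M N) A = emeasure M A + emeasure N A"
  unfolding add_measure_def
proof (rule emeasure_measure_of_sigma[OF _ _ _ A])
  show "sigma_algebra (space M) (sets M)"
    by (rule sets.sigma_algebra_axioms)
  show "positive (sets M) (\<lambda>A. emeasure M A + emeasure N A)"
    by (simp add: positive_def)
  show "countably_additive (sets M) (\<lambda>A. emeasure M A + emeasure N A)"
  proof (rule countably_additiveI)
    fix B :: "nat \<Rightarrow> 'a set"
    assume "range B \<subseteq> sets M" and "disjoint_family B"
    then show "(\<Sum>i. emeasure M (B i) + emeasure N (B i))
        = emeasure M (\<Union>i. B i) + emeasure N (\<Union>i. B i)"
      using sets by (simp add: suminf_add[symmetric] suminf_emeasure)
  qed
qed

(* A negative weight w would be truncated to 0. *)
definition point_mass :: "real \<Rightarrow> real \<Rightarrow> real measure" where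
  "point_mass w x = scale_measure (ennreal w) (return borel x)"

end

theory Submission
  imports Defs
begin

text \<open>On \<^term>\<open>{Vci<..Vr}\<close> the power is \<^term>\<open>\<lambda>v. a * v ^ 3\<close>, and the substitution
  \<open>p = a v\<^sup>3\<close> carries the Weibull density to the absolutely continuous part. On the two other pieces
  the power is constant, so their Weibull probabilities become point masses.\<close>

lemma borel_measurable_weibull_density [measurable]:
  "weibull_density k c \<in> borel_measurable borel"
  unfolding weibull_density_def by measurable

text \<open>The fundamental theorem of calculus applies because \<open>weibull_cdf\<close> is an
  antiderivative of the density on the positive half line. The bound \<open>0 < x\<close> keeps the
  interval away from 0, near which the density is unbounded for \<open>k < 1\<close>.\<close>

lemma emeasure_weibull_Ioc:
  assumes "0 < k" "0 < c" "0 < x" "x \<le> y"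
  shows "emeasure (density lborel (\<lambda>v. ennreal (weibull_density k c v))) {x<..y}
    = ennreal (weibull_cdf k c y - weibull_cdf k c x)"
proof -
  have "emeasure (density lborel (\<lambda>v. ennreal (weibull_density k c v))) {x<..y}
    = (\<integral>\<^sup>+v. ennreal (weibull_density k c v) * indicator {x<..y} v \<partial>lborel)"
    by (simp add: emeasure_density)
  \<comment> \<open>The fundamental theorem is stated for closed intervals; adding the null set
    \<open>{x}\<close> changes nothing.\<close>
  also have "\<dots> = (\<integral>\<^sup>+v. ennreal (weibull_density k c v) * indicator {x..y} v \<partial>lborel)"
    using AE_lborel_singleton[of x]
    by (intro nn_integral_cong_AE, eventually_elim) (auto split: split_indicator)
  also have "\<dots> = ennreal (weibull_cdf k c y - weibull_cdf k c x)"
  proof (rule nn_integral_FTC_Icc)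
    fix v assume "v \<in> {x..y}"
    with assms have "0 < v" by simp
    have "((\<lambda>v. 1 - exp (- ((v / c) powr k))) has_real_derivative weibull_density k c v) (at v)"
      using \<open>0 < v\<close> assms unfolding weibull_density_def
      by (auto intro!: derivative_eq_intros simp: field_simps)
    \<comment> \<open>The derivative was computed for the closed form; it passes to the case
      distinction in \<open>weibull_cdf\<close> because both agree near a positive point.\<close>
    moreover have "\<forall>\<^sub>F v in nhds v. 1 - exp (- ((v / c) powr k)) = weibull_cdf k c v"
      using eventually_nhds_in_open[of "{0<..}" v] \<open>0 < v\<close>
      by (auto simp: weibull_cdf_def elim!: eventually_mono)
    ultimately show "(weibull_cdf k c has_real_derivative weibull_density k c v) (at v)"
      by (subst (asm) DERIV_cong_ev) auto
    show "0 \<le> weibull_density k c v"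
      using assms by (simp add: weibull_density_def)
  qed (use assms in auto)
  finally show ?thesis .
qed

text \<open>The factor \<open>3 * a * v ^ 2\<close> is the Jacobian dp/dv. Since
  \<open>p powr (k / 3) = a powr (k / 3) * v powr k\<close>, the exponent turns into that of the
  Weibull density, and the powers of \<open>a\<close> cancel.\<close>

lemma weibull_density_cube_substitution:
  assumes "0 < k" "0 < c" "0 < a" "0 < v"
  defines "p \<equiv> a * v ^ 3"
  shows "k * p powr (k / 3 - 1) * exp (- (p powr (k / 3) / (a powr (k / 3) * c powr k)))
           / (3 * c powr k * a powr (k / 3)) * (3 * a * v ^ 2) = weibull_density k c v"
proof -
  have p3: "p powr (k / 3) = a powr (k / 3) * v powr k"
    using assms by (simp add: powr_mult powr_powr flip: powr_numeral)
  have p1: "p powr (k / 3 - 1) = a powr (k / 3) * v powr k / (a * v ^ 3)"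
    using assms p3 by (simp add: powr_diff)
  \<comment> \<open>With \<open>k - 1\<close> removed from the exponent, both sides are rational in
    \<open>v\<close>, \<open>v powr k\<close> and \<open>c powr k\<close> apart from a common
    exponential, so field arithmetic suffices.\<close>
  have d: "weibull_density k c v = k / v * (v powr k / c powr k) * exp (- (v powr k / c powr k))"
    using assms by (simp add: weibull_density_def powr_diff powr_divide field_simps)
  have "p powr (k / 3) / (a powr (k / 3) * c powr k) = v powr k / c powr k"
    using assms p3 by simp
  with assms show ?thesis
    unfolding d p1 by (simp add: field_simps power3_eq_cube power2_eq_square)
qed

text \<open>Change of variables along the increasing map \<open>v \<mapsto> a * v ^ 3\<close>,
  applied to the density cut down to the test set \<open>S\<close>.\<close>

lemma emeasure_weibull_cube:
  assumes "0 < k" "0 < c" "0 < a" "0 < x" "x \<le> y" and [measurable]: "S \<in> sets borel"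
  shows "emeasure (density lborel (\<lambda>v. ennreal (weibull_density k c v)))
      ({x<..y} \<inter> {v. a * v ^ 3 \<in> S})
    = emeasure (density lborel (\<lambda>p. ennreal
        (k * p powr (k / 3 - 1) * exp (- (p powr (k / 3) / (a powr (k / 3) * c powr k)))
           / (3 * c powr k * a powr (k / 3))
         * indicator {p. a * x ^ 3 < p \<and> p < a * y ^ 3} p))) S"
proof -
  define d where "d = (\<lambda>p. k * p powr (k / 3 - 1)
    * exp (- (p powr (k / 3) / (a powr (k / 3) * c powr k))) / (3 * c powr k * a powr (k / 3)))"
  have [measurable]: "d \<in> borel_measurable borel"
    unfolding d_def by measurable
  have "emeasure (density lborel (\<lambda>p. ennreal
      (d p * indicator {p. a * x ^ 3 < p \<and> p < a * y ^ 3} p))) S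
    = (\<integral>\<^sup>+p. ennreal (d p * indicator {p. a * x ^ 3 < p \<and> p < a * y ^ 3} p) * indicator S p \<partial>lborel)"
    by (subst emeasure_density) auto
  \<comment> \<open>The substitution rule wants a closed interval, so the two endpoints, a null set,
    are added. The indicator of \<open>S\<close> joins the integrand, which then only has to be
    measurable.\<close>
  also have "\<dots> = (\<integral>\<^sup>+p. ennreal (d p * indicator S p * indicator {a * x ^ 3..a * y ^ 3} p) \<partial>lborel)"
    using AE_lborel_singleton[of "a * x ^ 3"] AE_lborel_singleton[of "a * y ^ 3"]
    by (intro nn_integral_cong_AE, eventually_elim) (auto split: split_indicator)
  also have "\<dots> = (\<integral>\<^sup>+v. ennreal (d (a * v ^ 3) * indicator S (a * v ^ 3) * (3 * a * v ^ 2)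
      * indicator {x..y} v) \<partial>lborel)"
    using assms
    by (intro nn_integral_substitution)
      (auto intro!: derivative_eq_intros continuous_intros simp: set_borel_measurable_def)
  also have "\<dots> = (\<integral>\<^sup>+v. ennreal (weibull_density k c v)
      * indicator ({x<..y} \<inter> {v. a * v ^ 3 \<in> S}) v \<partial>lborel)"
    \<comment> \<open>Back to the half-open interval: the integrands can differ only at
      \<open>v = x\<close>.\<close>
    using AE_lborel_singleton[of x]
  proof (intro nn_integral_cong_AE, eventually_elim)
    fix v assume "v \<noteq> x"
    show "ennreal (d (a * v ^ 3) * indicator S (a * v ^ 3) * (3 * a * v ^ 2) * indicator {x..y} v)
      = ennreal (weibull_density k c v) * indicator ({x<..y} \<inter> {v. a * v ^ 3 \<in> S}) v"
    proof (cases "v \<in> {x..y}")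
      case True
      with assms have "d (a * v ^ 3) * (3 * a * v ^ 2) = weibull_density k c v"
        unfolding d_def by (intro weibull_density_cube_substitution) auto
      with True \<open>v \<noteq> x\<close> show ?thesis
        by (auto split: split_indicator)
    qed (auto split: split_indicator)
  qed
  also have "\<dots> = emeasure (density lborel (\<lambda>v. ennreal (weibull_density k c v)))
      ({x<..y} \<inter> {v. a * v ^ 3 \<in> S})"
    by (subst emeasure_density) auto
  finally show ?thesis
    unfolding d_def by simp
qed

lemma sets_point_mass [simp]: "sets (point_mass w x) = sets borel"
  by (simp add: point_mass_def)

lemma emeasure_point_mass:
  "S \<in> sets borel \<Longrightarrow> emeasure (point_mass w x) S = ennreal w * indicator S x"
  by (simp add: point_mass_def)

theorem theorem2:
  fixes k c \<rho> A C a Pr Vci Vr Vco :: real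
    and M :: "'a measure" and V Pw :: "'a \<Rightarrow> real"
  assumes "0 < k" "0 < c" "0 < \<rho>" "0 < A" "0 < C" "0 < Pr"
    and "0 < Vci" "Vci < Vr" "Vr < Vco"
    and "a = 1 / 2 * \<rho> * A * C"
    and "prob_space M"
    and "distributed M lborel V (\<lambda>v. ennreal (weibull_density k c v))"
    and "\<And>\<omega>. \<omega> \<in> space M \<Longrightarrow> Pw \<omega> = harvested_power a Vci Vr Vco Pr (V \<omega>)"
  shows "distr M borel Pw =
    add_measure
      (density lborel (\<lambda>p. ennreal
        (k * p powr (k / 3 - 1) * exp (- (p powr (k / 3) / (a powr (k / 3) * c powr k)))
           / (3 * c powr k * a powr (k / 3))
         * indicator {p. a * Vci ^ 3 < p \<and> p < a * Vr ^ 3} p)))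
      (add_measure
        (point_mass (weibull_cdf k c Vco - weibull_cdf k c Vr) Pr)
        (point_mass (weibull_cdf k c Vci + 1 - weibull_cdf k c Vco) 0))"
proof -
  let ?N = "density lborel (\<lambda>v. ennreal (weibull_density k c v))"
  let ?h = "harvested_power a Vci Vr Vco Pr"
  let ?F = "weibull_cdf k c"
  note pos = assms(1-9)
  have a: "0 < a"
    unfolding assms(10) using pos by simp
  have V [measurable]: "V \<in> borel_measurable M"
    using distributed_measurable[OF assms(12)] by simp
  have N: "distr M lborel V = ?N"
    using distributed_distr_eq_density[OF assms(12)] .
  \<comment> \<open>The Weibull density has total mass 1 because it is the density of the law of
    \<open>V\<close>; no improper integral is evaluated.\<close>
  have "prob_space (distr M lborel V)"
    using assms(11) by (rule prob_space.prob_space_distr) simp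
  then interpret N: prob_space ?N
    unfolding N .
  have "distr M borel Pw = distr M borel (\<lambda>\<omega>. ?h (V \<omega>))"
    by (rule distr_cong) (simp_all add: assms(13))
  also have "\<dots> = distr (distr M lborel V) borel ?h"
    by (subst distr_distr) (simp_all add: comp_def)
  finally have Pw: "distr M borel Pw = distr ?N borel ?h"
    unfolding N .
  \<comment> \<open>Taking the complement of a bounded interval covers both tails at once, including
    the neighbourhood of 0 and the negative half line.\<close>
  have out: "emeasure ?N (- {Vci<..Vco}) = ennreal (?F Vci + 1 - ?F Vco)"
  proof -
    \<comment> \<open>Subtraction in \<open>ennreal\<close> matches real subtraction only if the
      subtracted number is nonnegative.\<close>
    have mono: "?F Vci \<le> ?F Vco"
      using pos by (auto simp: weibull_cdf_def intro!: powr_mono2 divide_right_mono)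
    have "emeasure ?N (- {Vci<..Vco}) = 1 - emeasure ?N {Vci<..Vco}"
      using emeasure_compl[of "{Vci<..Vco}" ?N] N.emeasure_space_1
      by (simp add: Compl_eq_Diff_UNIV)
    also have "\<dots> = ennreal (1 - (?F Vco - ?F Vci))"
      using pos mono by (simp add: emeasure_weibull_Ioc ennreal_minus flip: ennreal_1)
    finally show ?thesis
      by (simp add: algebra_simps)
  qed
  show ?thesis
    unfolding Pw
  proof (rule measure_eqI)
    fix S assume "S \<in> sets (distr ?N borel ?h)"
    then have [measurable]: "S \<in> sets borel"
      by simp
    \<comment> \<open>The preimage of \<open>S\<close> splits along the three cases of the power. In
      \<open>?B\<close> and \<open>?D\<close> the second factor does not depend on \<open>v\<close>:
      it is everything or empty, which produces the indicator of a point mass.\<close>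
    let ?A = "{Vci<..Vr} \<inter> {v. a * v ^ 3 \<in> S}"
    let ?B = "{Vr<..Vco} \<inter> {v. Pr \<in> S}"
    let ?D = "- {Vci<..Vco} \<inter> {v. 0 \<in> S}"
    have [measurable]: "?A \<in> sets borel" "?B \<in> sets borel" "?D \<in> sets borel"
      by measurable
    have "?h -` S = ?A \<union> (?B \<union> ?D)"
      using pos by (auto simp: harvested_power_def split: if_splits)
    then have "emeasure (distr ?N borel ?h) S = emeasure ?N (?A \<union> (?B \<union> ?D))"
      by (subst emeasure_distr) auto
    also have "\<dots> = emeasure ?N ?A + emeasure ?N (?B \<union> ?D)"
      using pos by (intro plus_emeasure[symmetric]) auto
    also have "emeasure ?N (?B \<union> ?D) = emeasure ?N ?B + emeasure ?N ?D"
      using pos by (intro plus_emeasure[symmetric]) auto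
    also have "emeasure ?N ?B = emeasure (point_mass (?F Vco - ?F Vr) Pr) S"
      using pos by (cases "Pr \<in> S") (simp_all add: emeasure_weibull_Ioc emeasure_point_mass)
    also have "emeasure ?N ?D = emeasure (point_mass (?F Vci + 1 - ?F Vco) 0) S"
      using out by (cases "0 \<in> S") (simp_all add: emeasure_point_mass)
    finally show "emeasure (distr ?N borel ?h) S = emeasure (add_measure
      (density lborel (\<lambda>p. ennreal
        (k * p powr (k / 3 - 1) * exp (- (p powr (k / 3) / (a powr (k / 3) * c powr k)))
           / (3 * c powr k * a powr (k / 3))
         * indicator {p. a * Vci ^ 3 < p \<and> p < a * Vr ^ 3} p)))
      (add_measure (point_mass (?F Vco - ?F Vr) Pr) (point_mass (?F Vci + 1 - ?F Vco) 0))) S"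
      using pos a by (simp add: emeasure_add_measure emeasure_weibull_cube)
  qed simp
qed

end
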